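(* Let $(X,\tau)$ be a metrizable space and let $F=\{a_1,\dots,a_k\}\subseteq X$ be a set of $k$ distinct points, $2\le k<\infty$. Let $\sigma\in\mathcal L_F^m(\tau)$ and let $q$ be any metric on $X$ compatible with $\sigma$ (i.e. inducing $\sigma$). Put $$s_i(x)=\frac{q(x,a_i)}{1+q(x,a_i)}\qquad(i=1,\dots,k,\ x\in X).$$ Then $s=(s_1,\dots,s_k)$ belongs to $\mathcal G_F(\tau)$ and $\tau_s=\sigma$. Consequently every $\sigma\in\mathcal L_F^m(\tau)$ is induced by a metric of the form $$\rho_s(x,y)=\kappa(U_s(x),U_s(y))+\min\{H(U_s(x)),H(U_s(y))\}\,d(x,y)$$ with $s\in\mathcal G_F(\tau)$ and $d\le1$ a metric on $X$ inducing $\tau$.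
   Context: $\mathcal L_F^m(\tau)$ is the family of all metrizable topologies $\sigma$ on $X$ with $\sigma\subseteq\tau$ and $\sigma|_{X\setminus F}=\tau|_{X\setminus F}$ (equal subspace topologies on $X\setminus F$), ordered by inclusion. A compatible gauge system at $F$ is a $k$-tuple $s=(s_1,\dots,s_k)$ of $\tau$-continuous functions $s_i:X\to[0,1]$ with $s_i^{-1}(0)=\{a_i\}$ for all $i$ and $\inf_{x\in X}\max\{s_i(x),s_j(x)\}>0$ for all $i\ne j$. $\mathcal G_F(\tau)$ is the class of all compatible gauge systems at $F$. For $s\in\mathcal G_F(\tau)$, $\tau_s$ is the topology on $X$ in which $U\subseteq X$ is open exactly when $U\in\tau$ and, for every $i$ with $a_i\in U$, there is $\varepsilon_i>0$ such that $\{x: s_i(x)<\varepsilon_i\}\subseteq U$. $\Delta^{k-1}=\{r\in[0,1]^k:\sum_i r_i=1\}$ is the standard simplex, $\kappa(r,t)=\frac12\sum_{i=1}^k|r_i-t_i|$ and $H(r)=1-\max_{1\le i\le k}r_i$ for $r,t\in\Delta^{k-1}$. For $s\in\mathcal G_F(\tau)$ put $P_i(x)=\prod_{j\ne i}s_j(x)$, $u_i(x)=P_i(x)/\sum_{\ell=1}^kP_\ell(x)$ (the denominator is always positive), and $U_s(x)=(u_1(x),\dots,u_k(x))\in\Delta^{k-1}$. *)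

theory Defs
  imports "HOL-Analysis.Analysis"
begin

text \<open>The space \<open>X\<close> is \<open>topspace \<tau>\<close>; a tuple \<open>(s\<^sub>1,\<dots>,s\<^sub>k)\<close> is a function on \<open>nat\<close> of which only the
  values at the indices \<open>i < k\<close> are used, and \<open>F = a ` {..<k}\<close>.\<close>

definition metrizable_interval :: "'a topology \<Rightarrow> 'a set \<Rightarrow> 'a topology set" where
  "metrizable_interval \<tau> F =
    {\<sigma>. topspace \<sigma> = topspace \<tau> \<and> metrizable_space \<sigma> \<and>
         (\<forall>U. openin \<sigma> U \<longrightarrow> openin \<tau> U) \<and>
         subtopology \<sigma> (topspace \<tau> - F) = subtopology \<tau> (topspace \<tau> - F)}"

text \<open>The infimum below is over a nonempty set bounded below by \<open>0\<close> whenever the points \<open>a i\<close> lie in \<open>X\<close>,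
  so the conditionally complete \<open>Inf\<close> on \<open>real\<close> has its usual meaning.\<close>

definition gauge_systems :: "'a topology \<Rightarrow> nat \<Rightarrow> (nat \<Rightarrow> 'a) \<Rightarrow> (nat \<Rightarrow> 'a \<Rightarrow> real) set" where
  "gauge_systems \<tau> k a =
    {s. (\<forall>i<k. continuous_map \<tau> (top_of_set {0..1}) (s i)) \<and>
        (\<forall>i<k. {x \<in> topspace \<tau>. s i x = 0} = {a i}) \<and>
        (\<forall>i<k. \<forall>j<k. i \<noteq> j \<longrightarrow> 0 < (INF x\<in>topspace \<tau>. max (s i x) (s j x)))}"

definition gauge_topology ::
    "'a topology \<Rightarrow> nat \<Rightarrow> (nat \<Rightarrow> 'a) \<Rightarrow> (nat \<Rightarrow> 'a \<Rightarrow> real) \<Rightarrow> 'a topology" where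
  "gauge_topology \<tau> k a s = topology (\<lambda>U. openin \<tau> U \<and>
     (\<forall>i<k. a i \<in> U \<longrightarrow> (\<exists>\<epsilon>>0. {x \<in> topspace \<tau>. s i x < \<epsilon>} \<subseteq> U)))"

lemma openin_gauge_topology:
  "openin (gauge_topology \<tau> k a s) U \<longleftrightarrow> openin \<tau> U \<and>
     (\<forall>i<k. a i \<in> U \<longrightarrow> (\<exists>\<epsilon>>0. {x \<in> topspace \<tau>. s i x < \<epsilon>} \<subseteq> U))"
proof -
  let ?P = "\<lambda>U. openin \<tau> U \<and>
     (\<forall>i<k. a i \<in> U \<longrightarrow> (\<exists>\<epsilon>>0. {x \<in> topspace \<tau>. s i x < \<epsilon>} \<subseteq> U))"
  have "istopology ?P"
    unfolding istopology_def
  proof (intro conjI allI impI)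
    fix S T assume S: "?P S" and T: "?P T"
    show "openin \<tau> (S \<inter> T)" using S T by blast
    fix i assume i: "i < k" "a i \<in> S \<inter> T"
    obtain d where d: "d > 0" "{x \<in> topspace \<tau>. s i x < d} \<subseteq> S" using S i by blast
    obtain e where e: "e > 0" "{x \<in> topspace \<tau>. s i x < e} \<subseteq> T" using T i by blast
    have "min d e > 0" "{x \<in> topspace \<tau>. s i x < min d e} \<subseteq> S \<inter> T" using d e by auto
    then show "\<exists>\<epsilon>>0. {x \<in> topspace \<tau>. s i x < \<epsilon>} \<subseteq> S \<inter> T" by blast
  next
    fix \<K> assume K: "\<forall>K\<in>\<K>. ?P K"
    show "openin \<tau> (\<Union>\<K>)" using K by blast
    fix i assume i: "i < k" "a i \<in> \<Union>\<K>"
    then obtain K where "K \<in> \<K>" "a i \<in> K" by blast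
    then obtain e where "e > 0" "{x \<in> topspace \<tau>. s i x < e} \<subseteq> K" using K i by blast
    then show "\<exists>\<epsilon>>0. {x \<in> topspace \<tau>. s i x < \<epsilon>} \<subseteq> \<Union>\<K>" using \<open>K \<in> \<K>\<close> by blast
  qed
  then show ?thesis by (simp add: gauge_topology_def topology_inverse')
qed

definition simplex_dist :: "nat \<Rightarrow> (nat \<Rightarrow> real) \<Rightarrow> (nat \<Rightarrow> real) \<Rightarrow> real" where
  "simplex_dist k r t = (1/2) * (\<Sum>i<k. \<bar>r i - t i\<bar>)"

definition simplex_height :: "nat \<Rightarrow> (nat \<Rightarrow> real) \<Rightarrow> real" where
  "simplex_height k r = 1 - Max (r ` {..<k})"

definition gauge_prod :: "nat \<Rightarrow> (nat \<Rightarrow> 'a \<Rightarrow> real) \<Rightarrow> nat \<Rightarrow> 'a \<Rightarrow> real" where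
  "gauge_prod k s i x = (\<Prod>j\<in>{..<k} - {i}. s j x)"

definition gauge_coords :: "nat \<Rightarrow> (nat \<Rightarrow> 'a \<Rightarrow> real) \<Rightarrow> 'a \<Rightarrow> nat \<Rightarrow> real" where
  "gauge_coords k s x = (\<lambda>i. gauge_prod k s i x / (\<Sum>l<k. gauge_prod k s l x))"

definition gauge_metric ::
    "nat \<Rightarrow> (nat \<Rightarrow> 'a \<Rightarrow> real) \<Rightarrow> ('a \<Rightarrow> 'a \<Rightarrow> real) \<Rightarrow> 'a \<Rightarrow> 'a \<Rightarrow> real" where
  "gauge_metric k s d x y =
     simplex_dist k (gauge_coords k s x) (gauge_coords k s y) +
     min (simplex_height k (gauge_coords k s x)) (simplex_height k (gauge_coords k s y)) * d x y"

text \<open>The locale \<open>Metric_space\<close> also asks for nonnegativity and symmetry off the carrier. Every metric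
  on \<open>X\<close> extends by \<open>0\<close> to such a function, so this is no restriction on the metric.\<close>

definition metric_inducing :: "'a topology \<Rightarrow> ('a \<Rightarrow> 'a \<Rightarrow> real) \<Rightarrow> bool" where
  "metric_inducing \<tau> d \<longleftrightarrow>
     Metric_space (topspace \<tau>) d \<and> Metric_space.mtopology (topspace \<tau>) d = \<tau>"

end

theory Submission
  imports Defs
begin

text \<open>
  Let \<open>s\<close> be the gauges \<open>q(\<cdot>, a\<^sub>i) / (1 + q(\<cdot>, a\<^sub>i))\<close> of a metric \<open>q\<close> for \<open>\<sigma>\<close>. They are
  continuous for \<open>\<sigma>\<close>, hence for \<open>\<tau>\<close>, and by the triangle inequality a point cannot be closer than
  \<open>q(a\<^sub>i, a\<^sub>j) / 2\<close> to both \<open>a\<^sub>i\<close> and \<open>a\<^sub>j\<close>, which separates them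
  (\<open>metric_gauges_in_gauge_systems\<close>). Away from the finite set \<open>F\<close> the topologies \<open>\<sigma>\<close> and \<open>\<tau>\<close>
  agree, and since \<open>F\<close> is closed in \<open>\<sigma>\<close> they have the same open sets disjoint from \<open>F\<close>; at \<open>a\<^sub>i\<close> the
  small sublevel sets of \<open>s\<^sub>i\<close> are the small \<open>q\<close>-balls. So \<open>\<tau>\<^sub>s = \<sigma>\<close> (\<open>gauge_topology_metric_gauges\<close>).

  It remains to see that \<open>\<rho>\<^sub>s\<close> is a metric for \<open>\<tau>\<^sub>s\<close>, which holds for every gauge system. The map
  \<open>U\<^sub>s\<close> sends \<open>a\<^sub>i\<close> to the \<open>i\<close>-th vertex of the simplex and nothing else to a vertex, and the height
  \<open>H\<close> vanishes exactly at the vertices. The triangle inequality can only be in danger for a detour from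
  \<open>x\<close> to \<open>z\<close> through a point \<open>y\<close> that is closer to a vertex than both ends, where the weight of \<open>d\<close>
  drops. But then the coordinate of \<open>y\<close> at that vertex exceeds those of \<open>x\<close> and \<open>z\<close>, so the detour
  costs in \<open>\<kappa>\<close> at least the height that is lost (\<open>simplex_height_detour\<close>); as \<open>d \<le> 1\<close>, this pays
  for the drop.

  For the topology, near a point outside \<open>F\<close> the height is bounded below, so \<open>\<rho>\<^sub>s\<close> controls \<open>d\<close>,
  while conversely \<open>\<rho>\<^sub>s\<close> is \<open>\<tau>\<close>-continuous. At \<open>a\<^sub>i\<close> the distance \<open>\<rho>\<^sub>s(a\<^sub>i, x)\<close> is the defect
  \<open>1 - u\<^sub>i(x)\<close>, and separation makes this small exactly when \<open>s\<^sub>i(x)\<close> is small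
  (\<open>coord_defect_le\<close>, \<open>coord_defect_ge\<close>).
\<close>

section \<open>The height function on the simplex\<close>

lemma simplex_height_le:
  assumes "i < k"
  shows "r i \<le> 1 - simplex_height k r"
proof -
  have "r i \<le> Max (r ` {..<k})" using assms by (intro Max_ge) auto
  then show ?thesis by (simp add: simplex_height_def)
qed

lemma simplex_height_attained:
  assumes "0 < k"
  obtains i where "i < k" "r i = 1 - simplex_height k r"
proof -
  have "Max (r ` {..<k}) \<in> r ` {..<k}" using assms by (intro Max_in) auto
  then show thesis using that by (auto simp: simplex_height_def)
qed

lemma simplex_height_nonneg:
  assumes "0 < k" "\<And>i. i < k \<Longrightarrow> r i \<le> 1"
  shows "0 \<le> simplex_height k r"
proof -
  obtain i where "i < k" "r i = 1 - simplex_height k r"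
    using simplex_height_attained[OF assms(1)] by blast
  then show ?thesis using assms(2)[of i] by simp
qed

lemma simplex_dist_nonneg: "0 \<le> simplex_dist k r t"
  by (simp add: simplex_dist_def sum_nonneg)

lemma simplex_dist_commute: "simplex_dist k r t = simplex_dist k t r"
  by (simp add: simplex_dist_def abs_minus_commute)

lemma simplex_dist_self [simp]: "simplex_dist k r r = 0"
  by (simp add: simplex_dist_def)

lemma simplex_dist_eq_0_iff: "simplex_dist k r t = 0 \<longleftrightarrow> (\<forall>i<k. r i = t i)"
  by (auto simp: simplex_dist_def sum_nonneg_eq_0_iff)

text \<open>Coordinate \<open>i\<close> overshoots both ends by \<open>\<delta>\<close> and so contributes \<open>2 * \<delta>\<close> to the excess of the sum of
absolute differences; the other coordinates contribute nonnegatively, and \<open>\<kappa>\<close> carries the factor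
\<open>1/2\<close>.\<close>

lemma simplex_dist_detour_ge:
  assumes "i < k" "r i \<le> t i - \<delta>" "u i \<le> t i - \<delta>"
  shows "\<delta> \<le> simplex_dist k r t + simplex_dist k t u - simplex_dist k r u"
proof -
  let ?g = "\<lambda>j. \<bar>r j - t j\<bar> + \<bar>t j - u j\<bar> - \<bar>r j - u j\<bar>"
  have "2 * \<delta> \<le> ?g i" using assms by linarith
  also have "\<dots> \<le> (\<Sum>j<k. ?g j)"
    using assms(1) by (intro member_le_sum) auto
  finally show ?thesis
    by (simp add: simplex_dist_def sum.distrib sum_subtractf algebra_simps)
qed

lemma simplex_dist_triangle:
  "simplex_dist k r u \<le> simplex_dist k r t + simplex_dist k t u"
proof -
  have "(\<Sum>j<k. \<bar>r j - u j\<bar>) \<le> (\<Sum>j<k. \<bar>r j - t j\<bar> + \<bar>t j - u j\<bar>)"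
    by (intro sum_mono) auto
  then show ?thesis by (simp add: simplex_dist_def sum.distrib)
qed

text \<open>Take \<open>i\<close> to be a largest coordinate of the middle point \<open>t\<close>: it exceeds every coordinate of \<open>r\<close> and \<open>u\<close>
by at least the loss of height. When \<open>t\<close> is at least as high as one of the ends, the claim follows from
the triangle inequality alone.\<close>

lemma simplex_height_detour:
  assumes "0 < k"
  shows "min (simplex_height k r) (simplex_height k u) - simplex_height k t
    \<le> simplex_dist k r t + simplex_dist k t u - simplex_dist k r u"
proof -
  obtain i where i: "i < k" "t i = 1 - simplex_height k t"
    using simplex_height_attained[OF assms] by blast
  show ?thesis
    using i simplex_height_le[OF i(1), of r] simplex_height_le[OF i(1), of u]
    by (intro simplex_dist_detour_ge[OF i(1)]) auto
qed

text \<open>The degenerate detour that returns to its starting point. On the simplex itself the constant could be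
\<open>1\<close>; the value \<open>2\<close> holds for all tuples and suffices for continuity.\<close>

lemma simplex_height_lipschitz:
  assumes "0 < k"
  shows "simplex_height k r - simplex_height k t \<le> 2 * simplex_dist k r t"
  using simplex_height_detour[OF assms, of r r t] by (simp add: simplex_dist_commute)

lemma simplex_dist_vertex:
  assumes "i < k" "\<And>j. j < k \<Longrightarrow> r j = (if j = i then 1 else 0)"
    "\<And>j. j < k \<Longrightarrow> 0 \<le> t j" "(\<Sum>j<k. t j) = 1"
  shows "simplex_dist k r t = 1 - t i"
proof -
  have split: "(\<Sum>j<k. f j) = f i + (\<Sum>j\<in>{..<k}-{i}. f j)" for f :: "nat \<Rightarrow> real"
    using assms(1) by (intro sum.remove) auto
  have "(\<Sum>j\<in>{..<k}-{i}. \<bar>r j - t j\<bar>) = (\<Sum>j\<in>{..<k}-{i}. t j)"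
    using assms(2,3) by (intro sum.cong) auto
  moreover have "0 \<le> (\<Sum>j\<in>{..<k}-{i}. t j)" using assms(3) by (intro sum_nonneg) auto
  ultimately show ?thesis
    using assms(2)[OF assms(1)] split[of t] split[of "\<lambda>j. \<bar>r j - t j\<bar>"] assms(4)
    by (simp add: simplex_dist_def)
qed

section \<open>Simplex coordinates of a separated family of gauges\<close>

text \<open>A gauge system stripped of its topology, with \<open>c\<close> a common lower bound for the separation infima.
Nonnegativity is demanded at all points of the type, since \<open>Metric_space\<close> asks that a metric be
nonnegative off its carrier as well.\<close>

locale separated_gauges =
  fixes X :: "'a set" and k :: nat and a :: "nat \<Rightarrow> 'a" and s :: "nat \<Rightarrow> 'a \<Rightarrow> real" and c :: real
  assumes two: "2 \<le> k"
    and centre: "\<And>i. i < k \<Longrightarrow> a i \<in> X"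
    and nonneg: "\<And>i x. i < k \<Longrightarrow> 0 \<le> s i x"
    and le_one: "\<And>i x. \<lbrakk>i < k; x \<in> X\<rbrakk> \<Longrightarrow> s i x \<le> 1"
    and zero_iff: "\<And>i x. \<lbrakk>i < k; x \<in> X\<rbrakk> \<Longrightarrow> s i x = 0 \<longleftrightarrow> x = a i"
    and c_pos: "0 < c"
    and separated: "\<And>i j x. \<lbrakk>i < k; j < k; i \<noteq> j; x \<in> X\<rbrakk> \<Longrightarrow> c \<le> max (s i x) (s j x)"
begin

abbreviation P where "P \<equiv> gauge_prod k s"
abbreviation coord where "coord \<equiv> gauge_coords k s"
abbreviation height where "height x \<equiv> simplex_height k (coord x)"

lemma k_pos: "0 < k" using two by simp

lemma gauge_prod_nonneg: "i < k \<Longrightarrow> 0 \<le> P i x"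
  unfolding gauge_prod_def by (intro prod_nonneg) (auto simp: nonneg)

lemma coord_nonneg: "i < k \<Longrightarrow> 0 \<le> coord x i"
  unfolding gauge_coords_def by (intro divide_nonneg_nonneg sum_nonneg) (auto simp: gauge_prod_nonneg)

text \<open>When all products vanish, as may happen off \<open>X\<close>, the quotient is \<open>0\<close> by the convention for division.\<close>

lemma coord_le_one: "i < k \<Longrightarrow> coord x i \<le> 1"
proof -
  assume i: "i < k"
  have "P i x \<le> (\<Sum>l<k. P l x)" using i by (intro member_le_sum) (auto simp: gauge_prod_nonneg)
  moreover have "0 \<le> (\<Sum>l<k. P l x)" by (intro sum_nonneg) (auto simp: gauge_prod_nonneg)
  ultimately show ?thesis
    by (cases "(\<Sum>l<k. P l x) = 0") (auto simp: gauge_coords_def divide_le_eq_1)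
qed

lemma height_nonneg: "0 \<le> height x"
  by (simp add: coord_le_one k_pos simplex_height_nonneg)

lemma gauge_prod_le_one: "\<lbrakk>i < k; x \<in> X\<rbrakk> \<Longrightarrow> P i x \<le> 1"
  unfolding gauge_prod_def by (intro prod_le_1) (auto simp: nonneg le_one)

lemma gauge_prod_le_gauge:
  assumes "i < k" "j < k" "j \<noteq> i" "x \<in> X"
  shows "P j x \<le> s i x"
proof -
  have "P j x = s i x * (\<Prod>l\<in>{..<k} - {j} - {i}. s l x)"
    unfolding gauge_prod_def using assms by (intro prod.remove) auto
  moreover have "(\<Prod>l\<in>{..<k} - {j} - {i}. s l x) \<le> 1"
    by (intro prod_le_1) (auto simp: nonneg le_one assms)
  ultimately show ?thesis using mult_left_mono[of _ 1 "s i x"] nonneg[OF assms(1)] by simp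
qed

lemma gauge_prod_ge_power:
  assumes "l < k" "0 \<le> e" "\<And>j. \<lbrakk>j < k; j \<noteq> l\<rbrakk> \<Longrightarrow> e \<le> s j x"
  shows "e ^ (k - 1) \<le> P l x"
proof -
  have "(\<Prod>j\<in>{..<k} - {l}. e) \<le> P l x"
    unfolding gauge_prod_def using assms by (intro prod_mono) auto
  then show ?thesis using assms(1) by simp
qed

text \<open>By separation at most one gauge can be below \<open>c\<close> at a given point.\<close>

lemma ex_other_gauges_large:
  assumes x: "x \<in> X"
  obtains l where "l < k" "\<And>j. \<lbrakk>j < k; j \<noteq> l\<rbrakk> \<Longrightarrow> c \<le> s j x"
proof (cases "\<exists>l<k. s l x < c")
  case True
  then obtain l where l: "l < k" "s l x < c" by blast
  have "c \<le> s j x" if "j < k" "j \<noteq> l" for j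
    using separated[OF l(1) that(1) that(2)[symmetric] x] l(2) by linarith
  then show thesis using that[OF l(1)] by blast
next
  case False
  then have "c \<le> s j x" if "j < k" for j
    using that by (meson not_less)
  then show thesis using that[OF k_pos] by blast
qed

text \<open>If the index of the only gauge that may be below \<open>c\<close> happens to be \<open>i\<close>, then all gauges are at least
\<open>e\<close>, and any other index will do.\<close>

lemma ex_other_gauges_large_avoiding:
  assumes x: "x \<in> X" and i: "i < k" and e: "e \<le> c" "e \<le> s i x"
  obtains l where "l < k" "l \<noteq> i" "\<And>j. \<lbrakk>j < k; j \<noteq> l\<rbrakk> \<Longrightarrow> e \<le> s j x"
proof -
  obtain l where l: "l < k" "\<And>j. \<lbrakk>j < k; j \<noteq> l\<rbrakk> \<Longrightarrow> c \<le> s j x"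
    using ex_other_gauges_large[OF x] by blast
  obtain m where m: "m < k" "m \<noteq> i"
  proof
    show "(if i = 0 then 1 else 0) < k" using two by simp
    show "(if i = 0 then 1 else 0) \<noteq> i" by simp
  qed
  show thesis
  proof (cases "l = i")
    case True
    have "e \<le> s j x" if "j < k" for j
      using l(2)[of j] that e True by (cases "j = i") auto
    then show thesis using that[OF m] by blast
  next
    case False
    have "e \<le> s j x" if "j < k" "j \<noteq> l" for j
      using l(2)[OF that] e(1) by linarith
    then show thesis using that[OF l(1) False] by blast
  qed
qed

lemma sum_gauge_prod_ge: "x \<in> X \<Longrightarrow> c ^ (k - 1) \<le> (\<Sum>l<k. P l x)"
proof -
  assume x: "x \<in> X"
  obtain l where l: "l < k" "\<And>j. \<lbrakk>j < k; j \<noteq> l\<rbrakk> \<Longrightarrow> c \<le> s j x"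
    using ex_other_gauges_large[OF x] by blast
  have "c ^ (k - 1) \<le> P l x" using gauge_prod_ge_power[OF l(1) _ l(2)] c_pos by simp
  also have "\<dots> \<le> (\<Sum>l<k. P l x)"
    using l by (intro member_le_sum) (auto simp: gauge_prod_nonneg)
  finally show ?thesis .
qed

lemma sum_gauge_prod_pos: "x \<in> X \<Longrightarrow> 0 < (\<Sum>l<k. P l x)"
  using sum_gauge_prod_ge[of x] zero_less_power[OF c_pos, of "k - 1"] by linarith

lemma sum_gauge_prod_le: "x \<in> X \<Longrightarrow> (\<Sum>l<k. P l x) \<le> k"
  using sum_bounded_above[of "{..<k}" "\<lambda>l. P l x" 1] gauge_prod_le_one by simp

lemma sum_coord: "x \<in> X \<Longrightarrow> (\<Sum>i<k. coord x i) = 1"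
  using sum_gauge_prod_pos[of x] by (simp add: gauge_coords_def flip: sum_divide_distrib)

lemma coord_defect_eq:
  assumes "x \<in> X" "i < k"
  shows "1 - coord x i = (\<Sum>j\<in>{..<k} - {i}. P j x) / (\<Sum>l<k. P l x)"
proof -
  have "(\<Sum>l<k. P l x) = P i x + (\<Sum>j\<in>{..<k} - {i}. P j x)"
    using assms by (intro sum.remove) auto
  then show ?thesis using sum_gauge_prod_pos[OF assms(1)] by (simp add: gauge_coords_def field_simps)
qed

text \<open>Every product with index \<open>j \<noteq> i\<close> contains the factor \<open>s i x\<close>, while the sum of all products is at least
\<open>c ^ (k - 1)\<close>.\<close>

lemma coord_defect_le:
  assumes "x \<in> X" "i < k"
  shows "1 - coord x i \<le> k * s i x / c ^ (k - 1)"
proof -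
  have "(\<Sum>j\<in>{..<k} - {i}. P j x) \<le> of_nat (card ({..<k} - {i})) * s i x"
    using assms by (intro sum_bounded_above) (auto intro: gauge_prod_le_gauge)
  also have "\<dots> \<le> k * s i x"
    using assms nonneg by (intro mult_right_mono) auto
  finally show ?thesis
    unfolding coord_defect_eq[OF assms] using assms c_pos sum_gauge_prod_ge nonneg
    by (intro frac_le) auto
qed

text \<open>If \<open>s i x\<close> is not small, then some product with index \<open>l \<noteq> i\<close> has all its factors at least \<open>e\<close> and takes
a definite share of the total, which is at most \<open>k\<close>.\<close>

lemma coord_defect_ge:
  assumes "x \<in> X" "i < k" "0 < e" "e \<le> c" "e \<le> s i x"
  shows "e ^ (k - 1) / k \<le> 1 - coord x i"
proof -
  obtain l where l: "l < k" "l \<noteq> i" "\<And>j. \<lbrakk>j < k; j \<noteq> l\<rbrakk> \<Longrightarrow> e \<le> s j x"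
    using ex_other_gauges_large_avoiding[OF assms(1,2,4,5)] by blast
  have "e ^ (k - 1) \<le> P l x" using gauge_prod_ge_power[OF l(1) _ l(3)] assms(3) by simp
  also have "\<dots> \<le> (\<Sum>j\<in>{..<k} - {i}. P j x)"
    using l by (intro member_le_sum) (auto simp: gauge_prod_nonneg)
  finally show ?thesis
    unfolding coord_defect_eq[OF assms(1,2)]
    using assms sum_gauge_prod_pos sum_gauge_prod_le by (intro frac_le) (auto intro: sum_nonneg gauge_prod_nonneg)
qed

lemma coord_centre:
  assumes "i < k" "j < k"
  shows "coord (a i) j = (if j = i then 1 else 0)"
proof -
  have z: "P j (a i) = 0" if "j < k" "j \<noteq> i" for j
    using that gauge_prod_le_gauge[OF assms(1) that centre[OF assms(1)]] gauge_prod_nonneg[of j "a i"]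
      zero_iff[OF assms(1) centre[OF assms(1)]] by simp
  have one: "coord (a i) i = 1"
    using coord_defect_eq[OF centre[OF assms(1)] assms(1)] z by simp
  show ?thesis using one z assms by (simp add: gauge_coords_def)
qed

lemma height_centre: "i < k \<Longrightarrow> height (a i) = 0"
  using simplex_height_le[of i k "coord (a i)"] coord_centre[of i i] height_nonneg[of "a i"] by simp

lemma height_zero_imp_centre:
  assumes x: "x \<in> X" and h: "height x = 0"
  shows "x \<in> a ` {..<k}"
proof (rule ccontr)
  assume n: "x \<notin> a ` {..<k}"
  obtain i where i: "i < k" "coord x i = 1"
    using simplex_height_attained[OF k_pos, of "coord x"] h by auto
  have "0 < s i x" using n i zero_iff[OF i(1) x] nonneg[OF i(1), of x] by force
  then have "0 < min c (s i x)" using c_pos by simp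
  then have "0 < min c (s i x) ^ (k - 1) / k" using k_pos by simp
  also have "\<dots> \<le> 1 - coord x i"
    using \<open>0 < min c (s i x)\<close> by (intro coord_defect_ge[OF x i(1)]) auto
  finally show False using i by simp
qed

text \<open>The height vanishes at a centre, so only the distance to a vertex remains.\<close>

lemma gauge_metric_centre:
  assumes "i < k" "x \<in> X"
  shows "gauge_metric k s d (a i) x = 1 - coord x i"
  using simplex_dist_vertex[of i k "coord (a i)" "coord x"] assms
  by (simp add: gauge_metric_def height_centre height_nonneg coord_centre coord_nonneg sum_coord)

section \<open>The gauge metric\<close>

text \<open>The weight \<open>?m\<close> of \<open>d x z\<close> is split into the part \<open>?h\<close> that is available on both legs of the detour and
the height \<open>?m - ?h\<close> lost at \<open>y\<close>. The first part obeys the triangle inequality of \<open>d\<close>; the second is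
at most \<open>?m - ?h\<close> because \<open>d x z \<le> 1\<close>, and is paid for by the excess in \<open>\<kappa>\<close>.\<close>

lemma gauge_metric_triangle:
  assumes d: "Metric_space X d" and d1: "d x z \<le> 1"
    and X: "x \<in> X" "y \<in> X" "z \<in> X"
  shows "gauge_metric k s d x z \<le> gauge_metric k s d x y + gauge_metric k s d y z"
proof -
  interpret d: Metric_space X d by fact
  let ?m = "min (height x) (height z)"
  let ?h = "min ?m (height y)"
  have "?m * d x z = ?h * d x z + (?m - ?h) * d x z" by (simp add: algebra_simps)
  also have "\<dots> \<le> ?h * (d x y + d y z) + (?m - ?h)"
    using d.triangle[OF X] d1 height_nonneg
    by (intro add_mono mult_left_mono mult_left_le) auto
  also have "\<dots> \<le> min (height x) (height y) * d x y + min (height y) (height z) * d y z + (?m - ?h)"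
    unfolding distrib_left by (intro add_mono mult_right_mono) auto
  also have "?m - ?h \<le> simplex_dist k (coord x) (coord y) + simplex_dist k (coord y) (coord z)
      - simplex_dist k (coord x) (coord z)"
    using simplex_height_detour[OF k_pos, of "coord x" "coord z" "coord y"]
      simplex_dist_triangle[of k "coord x" "coord z" "coord y"] by (auto simp: min_def)
  finally show ?thesis by (simp add: gauge_metric_def)
qed

text \<open>Equal coordinates mean equal heights. At positive height \<open>d\<close> separates the points; at height \<open>0\<close> both
points are centres, and distinct centres have distinct vertices as coordinates.\<close>

lemma gauge_metric_eq_0_imp_eq:
  assumes d: "Metric_space X d" and X: "x \<in> X" "y \<in> X" and 0: "gauge_metric k s d x y = 0"
  shows "x = y"
proof -
  interpret d: Metric_space X d by fact
  have "0 \<le> min (height x) (height y) * d x y" by (simp add: height_nonneg)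
  with 0 simplex_dist_nonneg[of k "coord x" "coord y"]
  have k0: "simplex_dist k (coord x) (coord y) = 0" and h0: "min (height x) (height y) * d x y = 0"
    unfolding gauge_metric_def by linarith+
  have eq: "\<forall>i<k. coord x i = coord y i" using k0 by (simp add: simplex_dist_eq_0_iff)
  then have "coord x ` {..<k} = coord y ` {..<k}" by (intro image_cong) auto
  then have h: "height x = height y" by (simp add: simplex_height_def)
  show ?thesis
  proof (cases "height x = 0")
    case False
    then show ?thesis using h h0 X by simp
  next
    case True
    then obtain i j where ij: "i < k" "x = a i" "j < k" "y = a j"
      using height_zero_imp_centre X h by (metis imageE lessThan_iff)
    then have "i = j" using eq coord_centre by (metis zero_neq_one)
    then show ?thesis using ij by simp
  qed
qed

lemma Metric_space_gauge_metric:
  assumes d: "Metric_space X d" and d1: "\<And>x y. \<lbrakk>x \<in> X; y \<in> X\<rbrakk> \<Longrightarrow> d x y \<le> 1"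
  shows "Metric_space X (gauge_metric k s d)"
proof
  interpret d: Metric_space X d by fact
  fix x y z
  show "0 \<le> gauge_metric k s d x y"
    by (simp add: gauge_metric_def simplex_dist_nonneg height_nonneg)
  show "gauge_metric k s d x y = gauge_metric k s d y x"
    by (simp add: gauge_metric_def simplex_dist_commute min.commute d.commute)
  assume X: "x \<in> X" "y \<in> X"
  show "gauge_metric k s d x y = 0 \<longleftrightarrow> x = y"
    using gauge_metric_eq_0_imp_eq[OF d X] X by (auto simp: gauge_metric_def)
  assume "z \<in> X"
  then show "gauge_metric k s d x z \<le> gauge_metric k s d x y + gauge_metric k s d y z"
    using gauge_metric_triangle[OF d d1] X by blast
qed

text \<open>Off the centres the height is positive, and it varies by at most \<open>2 * \<kappa>\<close>, so on a small ball the
weight of \<open>d\<close> is bounded below.\<close>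

lemma gauge_ball_off_centres:
  assumes d: "Metric_space X d" and x: "x \<in> X" "x \<notin> a ` {..<k}" and e: "0 < e"
  obtains \<delta> where "0 < \<delta>" "\<And>y. \<lbrakk>y \<in> X; gauge_metric k s d x y < \<delta>\<rbrakk> \<Longrightarrow> d x y < e"
proof
  interpret d: Metric_space X d by fact
  have hx: "0 < height x"
    using height_zero_imp_centre[of x] x height_nonneg[of x] by force
  let ?\<delta> = "height x / 4 * min 1 e"
  show "0 < ?\<delta>" using hx e by simp
  (* The term min 1 e serves two ends: with 1 the height of y stays above half that of x, with e the
     distance d x y, weighted by at least this half, stays below e. *)
  fix y assume y: "y \<in> X" and r: "gauge_metric k s d x y < ?\<delta>"
  have "?\<delta> \<le> height x / 4" using hx by (simp add: mult_left_le)
  moreover have "simplex_dist k (coord x) (coord y) \<le> gauge_metric k s d x y"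
    by (simp add: gauge_metric_def height_nonneg)
  ultimately have hy: "height x / 2 \<le> min (height x) (height y)"
    using r hx simplex_height_lipschitz[OF k_pos, of "coord x" "coord y"] by linarith
  have "height x / 2 * d x y \<le> min (height x) (height y) * d x y"
    using hy by (intro mult_right_mono) auto
  also have "\<dots> \<le> gauge_metric k s d x y"
    by (simp add: gauge_metric_def simplex_dist_nonneg)
  also have "\<dots> < height x / 2 * e"
  proof -
    have "?\<delta> \<le> height x / 4 * e" using hx by (intro mult_left_mono) auto
    also have "\<dots> \<le> height x / 2 * e" using hx e by (intro mult_right_mono) auto
    finally show ?thesis using r by linarith
  qed
  finally show "d x y < e" using hx by simp
qed

lemma gauge_ball_at_centre:
  assumes "i < k" "0 < e"
  obtains \<delta> where "0 < \<delta>" "\<And>y. \<lbrakk>y \<in> X; gauge_metric k s d (a i) y < \<delta>\<rbrakk> \<Longrightarrow> s i y < e"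
proof
  let ?e = "min c e"
  show "0 < ?e ^ (k - 1) / k" using c_pos assms k_pos by simp
  fix y assume y: "y \<in> X" "gauge_metric k s d (a i) y < ?e ^ (k - 1) / k"
  show "s i y < e"
  proof (rule ccontr)
    assume "\<not> s i y < e"
    then have "?e ^ (k - 1) / k \<le> 1 - coord y i"
      using assms c_pos by (intro coord_defect_ge[OF y(1)]) auto
    then show False using y gauge_metric_centre[OF assms(1) y(1)] by simp
  qed
qed

lemma gauge_sublevel_in_ball:
  assumes "i < k" "0 < r"
  obtains \<epsilon> where "0 < \<epsilon>" "\<And>y. \<lbrakk>y \<in> X; s i y < \<epsilon>\<rbrakk> \<Longrightarrow> gauge_metric k s d (a i) y < r"
proof
  show "0 < r * c ^ (k - 1) / k" using assms c_pos k_pos by simp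
  fix y assume y: "y \<in> X" "s i y < r * c ^ (k - 1) / k"
  then have "k * s i y / c ^ (k - 1) < r"
    using c_pos k_pos by (simp add: field_simps)
  then show "gauge_metric k s d (a i) y < r"
    using coord_defect_le[OF y(1) assms(1)] gauge_metric_centre[OF assms(1) y(1)] by simp
qed

lemma continuous_map_coord:
  assumes "\<And>i. i < k \<Longrightarrow> continuous_map \<tau> euclideanreal (s i)" "topspace \<tau> = X" "i < k"
  shows "continuous_map \<tau> euclideanreal (\<lambda>x. coord x i)"
proof -
  have "continuous_map \<tau> euclideanreal (P l)" if "l < k" for l
    unfolding gauge_prod_def using assms(1) by (intro continuous_map_prod) auto
  moreover have "(\<Sum>l<k. P l x) \<noteq> 0" if "x \<in> topspace \<tau>" for x
    using sum_gauge_prod_pos[of x] that assms(2) by simp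
  ultimately show ?thesis
    unfolding gauge_coords_def using assms(3)
    by (intro continuous_map_real_divide continuous_map_sum) auto
qed

text \<open>
The term \<open>\<kappa>\<close> is continuous in \<open>y\<close>, and the weight of \<open>d\<close> is at most the height of the centre \<open>x\<close>, a
constant.\<close>

lemma gauge_ball_contains_open:
  assumes s: "\<And>i. i < k \<Longrightarrow> continuous_map \<tau> euclideanreal (s i)"
    and d: "metric_inducing \<tau> d" and top: "topspace \<tau> = X" and x: "x \<in> X" and r: "0 < r"
  obtains V where "openin \<tau> V" "x \<in> V" "\<And>y. y \<in> V \<Longrightarrow> gauge_metric k s d x y < r"
proof -
  interpret d: Metric_space X d using d top by (simp add: metric_inducing_def)
  have td: "d.mtopology = \<tau>" using d top by (simp add: metric_inducing_def)
  let ?f = "\<lambda>y. simplex_dist k (coord x) (coord y)"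
  have "continuous_map \<tau> euclideanreal ?f"
    unfolding simplex_dist_def
    by (intro continuous_intros continuous_map_real_mult_left continuous_map_coord s top) auto
  then have "openin \<tau> {y \<in> topspace \<tau>. ?f y < r / 2}"
    unfolding continuous_map_upper_lower_semicontinuous_lt by blast
  moreover obtain e where e: "0 < e" "height x * e \<le> r / 2"
  proof
    show "0 < r / (2 * (1 + height x))" using r height_nonneg[of x] by simp
    show "height x * (r / (2 * (1 + height x))) \<le> r / 2"
      using r height_nonneg[of x] by (simp add: field_simps)
  qed
  moreover have "openin \<tau> (d.mball x e)" using d.openin_mball td by metis
  ultimately have "openin \<tau> ({y \<in> topspace \<tau>. ?f y < r / 2} \<inter> d.mball x e)" by blast
  moreover have "gauge_metric k s d x y < r" if "?f y < r / 2" "d x y < e" for y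
  proof -
    have "min (height x) (height y) * d x y \<le> height x * e"
      using that height_nonneg by (intro mult_mono) auto
    then show ?thesis using that e by (simp add: gauge_metric_def)
  qed
  ultimately show thesis using that[of "{y \<in> topspace \<tau>. ?f y < r / 2} \<inter> d.mball x e"] x e r top
    by auto
qed

lemma metric_inducing_gauge_metric:
  assumes s: "\<And>i. i < k \<Longrightarrow> continuous_map \<tau> euclideanreal (s i)"
    and d: "metric_inducing \<tau> d" and top: "topspace \<tau> = X"
    and d1: "\<And>x y. \<lbrakk>x \<in> X; y \<in> X\<rbrakk> \<Longrightarrow> d x y \<le> 1"
  shows "Metric_space X (gauge_metric k s d)"
    "Metric_space.mtopology X (gauge_metric k s d) = gauge_topology \<tau> k a s"
proof -
  interpret d: Metric_space X d using d top by (simp add: metric_inducing_def)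
  have td: "d.mtopology = \<tau>" using d top by (simp add: metric_inducing_def)
  show "Metric_space X (gauge_metric k s d)"
    by (rule Metric_space_gauge_metric[OF d.Metric_space_axioms d1])
  then interpret g: Metric_space X "gauge_metric k s d" .
  show "g.mtopology = gauge_topology \<tau> k a s"
    unfolding topology_eq
  proof (intro allI iffI)
    fix U assume U: "openin (gauge_topology \<tau> k a s) U"
    then have Ut: "openin \<tau> U"
      and Ue: "\<And>i. \<lbrakk>i < k; a i \<in> U\<rbrakk> \<Longrightarrow> \<exists>\<epsilon>>0. {x \<in> X. s i x < \<epsilon>} \<subseteq> U"
      using top by (auto simp: openin_gauge_topology)
    have UX: "U \<subseteq> X" using openin_subset[OF Ut] top by simp
    have "\<exists>\<delta>>0. g.mball x \<delta> \<subseteq> U" if x: "x \<in> U" for x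
    proof (cases "x \<in> a ` {..<k}")
      case True
      then obtain i where i: "i < k" "x = a i" by auto
      then obtain e where e: "0 < e" "{y \<in> X. s i y < e} \<subseteq> U" using Ue x by blast
      obtain \<delta> where "0 < \<delta>" "\<And>y. \<lbrakk>y \<in> X; gauge_metric k s d (a i) y < \<delta>\<rbrakk> \<Longrightarrow> s i y < e"
        using gauge_ball_at_centre[OF i(1) e(1)] by blast
      then show ?thesis using e i by (intro exI[of _ \<delta>]) auto
    next
      case False
      obtain e where e: "0 < e" "d.mball x e \<subseteq> U"
        using Ut x unfolding td[symmetric] d.openin_mtopology by blast
      obtain \<delta> where "0 < \<delta>" "\<And>y. \<lbrakk>y \<in> X; gauge_metric k s d x y < \<delta>\<rbrakk> \<Longrightarrow> d x y < e"
        using gauge_ball_off_centres[OF d.Metric_space_axioms _ False e(1)] x UX by blast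
      then show ?thesis using e x UX by (intro exI[of _ \<delta>]) auto
    qed
    then show "openin g.mtopology U" using UX by (simp add: g.openin_mtopology)
  next
    fix U assume U: "openin g.mtopology U"
    then have UX: "U \<subseteq> X" and Ub: "\<And>x. x \<in> U \<Longrightarrow> \<exists>r>0. g.mball x r \<subseteq> U"
      by (auto simp: g.openin_mtopology)
    have "openin \<tau> U"
    proof (subst openin_subopen, intro ballI)
      fix x assume x: "x \<in> U"
      then obtain r where r: "0 < r" "g.mball x r \<subseteq> U" using Ub by blast
      obtain V where V: "openin \<tau> V" "x \<in> V" "\<And>y. y \<in> V \<Longrightarrow> gauge_metric k s d x y < r"
        using gauge_ball_contains_open[OF s d top _ r(1)] x UX by blast
      moreover have "V \<subseteq> X" using openin_subset[OF V(1)] top by simp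
      ultimately have "V \<subseteq> g.mball x r" using x UX by auto
      then show "\<exists>V. openin \<tau> V \<and> x \<in> V \<and> V \<subseteq> U" using r V by blast
    qed
    moreover have "\<exists>\<epsilon>>0. {x \<in> X. s i x < \<epsilon>} \<subseteq> U" if i: "i < k" "a i \<in> U" for i
    proof -
      obtain r where r: "0 < r" "g.mball (a i) r \<subseteq> U" using Ub i by blast
      obtain \<epsilon> where "0 < \<epsilon>" "\<And>y. \<lbrakk>y \<in> X; s i y < \<epsilon>\<rbrakk> \<Longrightarrow> gauge_metric k s d (a i) y < r"
        using gauge_sublevel_in_ball[OF i(1) r(1)] by blast
      moreover from this have "{x \<in> X. s i x < \<epsilon>} \<subseteq> g.mball (a i) r"
        using centre[OF i(1)] by auto
      ultimately show ?thesis using r by blast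
    qed
    ultimately show "openin (gauge_topology \<tau> k a s) U" by (simp add: openin_gauge_topology top)
  qed
qed

end

text \<open>There are finitely many pairs of indices, so the smallest separation infimum is a uniform constant.\<close>

lemma separated_gauges_of_gauge_systems:
  assumes s: "s \<in> gauge_systems \<tau> k a" and two: "2 \<le> k"
    and centre: "\<And>i. i < k \<Longrightarrow> a i \<in> topspace \<tau>"
    and nonneg: "\<And>i x. i < k \<Longrightarrow> 0 \<le> s i x"
  obtains c where "separated_gauges (topspace \<tau>) k a s c"
proof -
  let ?I = "\<lambda>(i, j). INF x\<in>topspace \<tau>. max (s i x) (s j x)"
  let ?A = "{p \<in> {..<k} \<times> {..<k}. fst p \<noteq> snd p}"
  have fin: "finite ?A" by simp
  have ne: "(0, 1) \<in> ?A" using two by auto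
  define c where "c = Min (?I ` ?A)"
  have c_pos: "0 < c"
    unfolding c_def using fin ne s by (subst Min_gr_iff) (auto simp: gauge_systems_def)
  have sep: "c \<le> max (s i x) (s j x)" if "i < k" "j < k" "i \<noteq> j" "x \<in> topspace \<tau>" for i j x
  proof -
    have "c \<le> ?I (i, j)" unfolding c_def using that fin by (intro Min_le) auto
    also have "?I (i, j) \<le> max (s i x) (s j x)"
      unfolding prod.case
    proof (rule cINF_lower)
      show "bdd_below ((\<lambda>x. max (s i x) (s j x)) ` topspace \<tau>)"
        using that nonneg by (intro bdd_belowI2[where m = 0]) (auto simp: le_max_iff_disj)
    qed (rule that)
    finally show ?thesis .
  qed
  have sle: "s i x \<le> 1" if "i < k" "x \<in> topspace \<tau>" for i x
    using s that by (fastforce simp: gauge_systems_def continuous_map_in_subtopology)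
  have "separated_gauges (topspace \<tau>) k a s c"
  proof
    show "s i x = 0 \<longleftrightarrow> x = a i" if "i < k" "x \<in> topspace \<tau>" for i x
      using s that by (auto simp: gauge_systems_def)
  qed (use two centre nonneg c_pos sep sle in auto)
  then show thesis using that by blast
qed

section \<open>Gauges of a metric\<close>

lemma metric_gauge_less_iff:
  assumes "0 \<le> (t::real)" "0 \<le> e" "e < 1"
  shows "t / (1 + t) < e \<longleftrightarrow> t < e / (1 - e)"
  using assms by (simp add: field_simps)

lemma continuous_map_metric_gauge:
  assumes q: "metric_inducing \<sigma> q" and p: "p \<in> topspace \<sigma>"
  shows "continuous_map \<sigma> (top_of_set {0..1}) (\<lambda>x. q x p / (1 + q x p))"
proof -
  interpret q: Metric_space "topspace \<sigma>" q using q by (simp add: metric_inducing_def)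
  have tq: "q.mtopology = \<sigma>" using q by (simp add: metric_inducing_def)
  have pos: "0 < 1 + q x p" for x using q.nonneg[of x p] by linarith
  have "continuous_map \<sigma> euclideanreal (\<lambda>x. q x p)"
    using continuous_on_mdist[of p "metric (topspace \<sigma>, q)"] p tq
    by (simp add: mtopology_of_def q.commute[of _ p])
  then have "continuous_map \<sigma> euclideanreal (\<lambda>x. q x p / (1 + q x p))"
    by (intro continuous_intros) (use pos in \<open>auto simp: less_imp_neq[symmetric]\<close>)
  then show ?thesis using pos by (auto simp: continuous_map_in_subtopology divide_le_eq_1)
qed

lemma metric_gauges_in_gauge_systems:
  assumes \<sigma>: "topspace \<sigma> = topspace \<tau>" "\<And>U. openin \<sigma> U \<Longrightarrow> openin \<tau> U"
    and q: "metric_inducing \<sigma> q"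
    and inj: "inj_on a {..<k}" and a: "a ` {..<k} \<subseteq> topspace \<tau>"
  shows "(\<lambda>i x. q x (a i) / (1 + q x (a i))) \<in> gauge_systems \<tau> k a"
proof -
  let ?s = "\<lambda>i x. q x (a i) / (1 + q x (a i))"
  interpret q: Metric_space "topspace \<tau>" q using q \<sigma> by (simp add: metric_inducing_def)
  have pos: "0 < 1 + q x y" for x y using q.nonneg[of x y] by linarith
  have "continuous_map \<tau> (top_of_set {0..1}) (?s i)" if "i < k" for i
    using continuous_map_metric_gauge[OF q, of "a i"] that a \<sigma>
    unfolding continuous_map_def by (auto simp: image_subset_iff)
  moreover have "{x \<in> topspace \<tau>. ?s i x = 0} = {a i}" if "i < k" for i
  proof -
    have "?s i x = 0 \<longleftrightarrow> q x (a i) = 0" for x using pos[of x "a i"] by simp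
    then show ?thesis using that a by (auto simp: image_subset_iff)
  qed
  moreover have "0 < (INF x\<in>topspace \<tau>. max (?s i x) (?s j x))"
    if ij: "i < k" "j < k" "i \<noteq> j" for i j
  proof -
    have ai: "a i \<in> topspace \<tau>" and aj: "a j \<in> topspace \<tau>" using a ij by auto
    define t where "t = q (a i) (a j) / 2"
    have "a i \<noteq> a j" using inj ij by (auto dest: inj_onD)
    then have t: "0 < t" using ai aj by (simp add: t_def q.mdist_pos_less)
    have mono: "t / (1 + t) \<le> u / (1 + u)" if "t \<le> u" for u
      using t that by (simp add: field_simps)
    have "t / (1 + t) \<le> max (?s i x) (?s j x)" if x: "x \<in> topspace \<tau>" for x
    proof -
      have "q (a i) (a j) \<le> q x (a i) + q x (a j)"
        using q.triangle[OF ai x aj] by (simp add: q.commute)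
      then have "t \<le> q x (a i) \<or> t \<le> q x (a j)" by (auto simp: t_def)
      then show ?thesis using mono by (auto simp: le_max_iff_disj)
    qed
    then have "t / (1 + t) \<le> (INF x\<in>topspace \<tau>. max (?s i x) (?s j x))"
      using ai by (intro cINF_greatest) auto
    moreover have "0 < t / (1 + t)" using t by simp
    ultimately show ?thesis by linarith
  qed
  ultimately show ?thesis by (simp add: gauge_systems_def)
qed

text \<open>A \<open>\<tau>\<^sub>s\<close>-open set \<open>U\<close> is the union of \<open>U - F\<close>, which is \<open>\<sigma>\<close>-open because the topologies agree on the
\<open>\<sigma>\<close>-open complement of \<open>F\<close>, and of gauge sublevel sets, which are \<open>\<sigma>\<close>-open by continuity.\<close>

lemma gauge_topology_metric_gauges:
  assumes \<sigma>: "\<sigma> \<in> metrizable_interval \<tau> (a ` {..<k})"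
    and q: "metric_inducing \<sigma> q" and a: "a ` {..<k} \<subseteq> topspace \<tau>"
  shows "gauge_topology \<tau> k a (\<lambda>i x. q x (a i) / (1 + q x (a i))) = \<sigma>"
proof -
  let ?F = "a ` {..<k}"
  let ?s = "\<lambda>i x. q x (a i) / (1 + q x (a i))"
  have top: "topspace \<sigma> = topspace \<tau>" and met: "metrizable_space \<sigma>"
    and coarser: "\<And>U. openin \<sigma> U \<Longrightarrow> openin \<tau> U"
    and agree: "subtopology \<sigma> (topspace \<tau> - ?F) = subtopology \<tau> (topspace \<tau> - ?F)"
    using \<sigma> by (auto simp: metrizable_interval_def)
  interpret q: Metric_space "topspace \<tau>" q using q top by (simp add: metric_inducing_def)
  have tq: "q.mtopology = \<sigma>" using q top by (simp add: metric_inducing_def)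
  show ?thesis
    unfolding topology_eq
  proof (intro allI iffI)
    fix U assume U: "openin \<sigma> U"
    have "\<exists>\<epsilon>>0. {x \<in> topspace \<tau>. ?s i x < \<epsilon>} \<subseteq> U" if i: "i < k" "a i \<in> U" for i
    proof -
      obtain r where r: "0 < r" "q.mball (a i) r \<subseteq> U"
        using U i unfolding tq[symmetric] q.openin_mtopology by blast
      (* the value at r of the increasing map t / (1 + t) that turns q into the gauge *)
      define e where "e = r / (1 + r)"
      have e: "0 < e" "e < 1" "e / (1 - e) = r" using r by (auto simp: e_def field_simps)
      have "{x \<in> topspace \<tau>. ?s i x < e} \<subseteq> q.mball (a i) r"
        using e i a by (auto simp: metric_gauge_less_iff q.commute)
      then show ?thesis using e r by blast
    qed
    then show "openin (gauge_topology \<tau> k a ?s) U"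
      using coarser[OF U] by (simp add: openin_gauge_topology)
  next
    fix U assume "openin (gauge_topology \<tau> k a ?s) U"
    then have Ut: "openin \<tau> U"
      and Ue: "\<And>i. \<lbrakk>i < k; a i \<in> U\<rbrakk> \<Longrightarrow> \<exists>\<epsilon>>0. {x \<in> topspace \<tau>. ?s i x < \<epsilon>} \<subseteq> U"
      by (auto simp: openin_gauge_topology)
    have UX: "U \<subseteq> topspace \<tau>" using openin_subset[OF Ut] .
    have "closedin \<sigma> ?F"
      using met a top by (intro closedin_Hausdorff_finite metrizable_imp_Hausdorff_space) auto
    then have openF: "openin \<sigma> (topspace \<tau> - ?F)" using top by (auto simp: closedin_def)
    have "openin (subtopology \<tau> (topspace \<tau> - ?F)) (U - ?F)"
      using Ut UX by (auto simp: openin_subtopology intro!: exI[of _ U])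
    then have away: "openin \<sigma> (U - ?F)"
      using openF by (simp add: agree[symmetric] openin_open_subtopology)
    show "openin \<sigma> U"
    proof (subst openin_subopen, intro ballI)
      fix x assume x: "x \<in> U"
      show "\<exists>V. openin \<sigma> V \<and> x \<in> V \<and> V \<subseteq> U"
      proof (cases "x \<in> ?F")
        case False
        then show ?thesis using away x by blast
      next
        case True
        then obtain i where i: "i < k" "x = a i" by auto
        then obtain e where e: "0 < e" "{x \<in> topspace \<tau>. ?s i x < e} \<subseteq> U" using Ue x by blast
        have "continuous_map \<sigma> euclideanreal (?s i)"
          using continuous_map_metric_gauge[OF q, of "a i"] i a top
          by (auto simp: continuous_map_in_subtopology)
        then have "openin \<sigma> {x \<in> topspace \<tau>. ?s i x < e}"
          unfolding continuous_map_upper_lower_semicontinuous_lt top by blast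
        moreover have "x \<in> {x \<in> topspace \<tau>. ?s i x < e}" using i x UX e by auto
        ultimately show ?thesis using e by blast
      qed
    qed
  qed
qed

lemma metric_inducing_exists:
  assumes "metrizable_space \<sigma>"
  obtains q where "metric_inducing \<sigma> q"
proof -
  obtain M q where "Metric_space M q" "\<sigma> = Metric_space.mtopology M q"
    using assms by (auto simp: metrizable_space_def)
  then have "metric_inducing \<sigma> q" by (simp add: metric_inducing_def Metric_space.topspace_mtopology)
  then show thesis using that by blast
qed

lemma metric_inducing_bounded_exists:
  assumes "metrizable_space \<tau>"
  obtains d where "metric_inducing \<tau> d" "\<And>x y. d x y \<le> 1"
proof -
  obtain q where q: "metric_inducing \<tau> q" using metric_inducing_exists[OF assms] .
  interpret q: Metric_space "topspace \<tau>" q using q by (simp add: metric_inducing_def)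
  let ?d = "q.capped_dist 1"
  interpret d: Metric_space "topspace \<tau>" ?d by (rule q.capped_dist)
  have "d.mtopology = mtopology_of (metric (topspace \<tau>, ?d))"
    by (simp add: mtopology_of_def)
  also have "\<dots> = mtopology_of (capped_metric 1 (metric (topspace \<tau>, q)))"
    by (simp add: capped_metric_def)
  also have "\<dots> = \<tau>"
    using q by (simp add: mtopology_capped_metric metric_inducing_def)
  finally have "metric_inducing \<tau> ?d"
    using d.Metric_space_axioms by (simp add: metric_inducing_def)
  moreover have "?d x y \<le> 1" for x y by (simp add: q.capped_dist_def)
  ultimately show thesis using that by blast
qed

theorem theorem4p1:
  fixes \<tau> :: "'a topology" and k :: nat and a :: "nat \<Rightarrow> 'a" and F :: "'a set"
  assumes "metrizable_space \<tau>"
    and "2 \<le> k"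
    and "inj_on a {..<k}"
    and "F = a ` {..<k}"
    and "F \<subseteq> topspace \<tau>"
  shows "(\<forall>\<sigma>\<in>metrizable_interval \<tau> F. \<forall>q. metric_inducing \<sigma> q \<longrightarrow>
            (let s = (\<lambda>i x. q x (a i) / (1 + q x (a i)))
             in s \<in> gauge_systems \<tau> k a \<and> gauge_topology \<tau> k a s = \<sigma>)) \<and>
         (\<forall>\<sigma>\<in>metrizable_interval \<tau> F. \<exists>s\<in>gauge_systems \<tau> k a. \<exists>d.
            metric_inducing \<tau> d \<and> (\<forall>x\<in>topspace \<tau>. \<forall>y\<in>topspace \<tau>. d x y \<le> 1) \<and>
            metric_inducing \<sigma> (gauge_metric k s d))"
proof -
  let ?s = "\<lambda>q i x. q x (a i) / (1 + q x (a i) :: real)"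
  have a: "a ` {..<k} \<subseteq> topspace \<tau>" using assms by simp
  have gauges: "?s q \<in> gauge_systems \<tau> k a" and topology: "gauge_topology \<tau> k a (?s q) = \<sigma>"
    if "\<sigma> \<in> metrizable_interval \<tau> F" "metric_inducing \<sigma> q" for \<sigma> q
  proof -
    show "?s q \<in> gauge_systems \<tau> k a"
      using that by (intro metric_gauges_in_gauge_systems[where \<sigma> = \<sigma>] assms a)
        (auto simp: metrizable_interval_def)
    show "gauge_topology \<tau> k a (?s q) = \<sigma>"
      using that assms by (intro gauge_topology_metric_gauges a) auto
  qed
  have "\<exists>s\<in>gauge_systems \<tau> k a. \<exists>d. metric_inducing \<tau> d \<and>
      (\<forall>x\<in>topspace \<tau>. \<forall>y\<in>topspace \<tau>. d x y \<le> 1) \<and> metric_inducing \<sigma> (gauge_metric k s d)"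
    if \<sigma>: "\<sigma> \<in> metrizable_interval \<tau> F" for \<sigma>
  proof -
    have top: "topspace \<sigma> = topspace \<tau>" using \<sigma> by (simp add: metrizable_interval_def)
    obtain q where q: "metric_inducing \<sigma> q"
      using metric_inducing_exists \<sigma> by (auto simp: metrizable_interval_def)
    obtain d where d: "metric_inducing \<tau> d" "\<And>x y. d x y \<le> 1"
      using metric_inducing_bounded_exists[OF assms(1)] by blast
    have "0 \<le> q x y" for x y
      using q Metric_space.nonneg[of "topspace \<sigma>" q] by (simp add: metric_inducing_def)
    then have "0 \<le> ?s q i x" for i x by simp
    then obtain c where "separated_gauges (topspace \<tau>) k a (?s q) c"
      using separated_gauges_of_gauge_systems[OF gauges[OF \<sigma> q] assms(2)] a
      by (metis image_subset_iff lessThan_iff)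
    then interpret separated_gauges "topspace \<tau>" k a "?s q" c .
    have "continuous_map \<tau> euclideanreal (?s q i)" if "i < k" for i
      using gauges[OF \<sigma> q] that by (auto simp: gauge_systems_def continuous_map_in_subtopology)
    then have "metric_inducing \<sigma> (gauge_metric k (?s q) d)"
      using metric_inducing_gauge_metric[of \<tau> d] d topology[OF \<sigma> q] top
      by (simp add: metric_inducing_def)
    then show ?thesis using gauges[OF \<sigma> q] d by blast
  qed
  then show ?thesis using gauges topology by (simp add: Let_def)
qed

end
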